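(* Let $B$ be a noise-type Boolean algebra of $\sigma$-fields on a probability space $(\Omega,\mathcal F,P)$, let $H=L_2(\Omega,\mathcal F,P)$, and let $b\subset B$ be a Boolean subalgebra. Let $\psi\in H$ be such that (i) for all $x,y\in b$ with $x\wedge y=0$, $Q_{x\vee y}\psi=Q_x\psi+Q_y\psi$; (ii) $\psi$ is $b$-atomless: for every $\varepsilon>0$ there exists a partition of unity $x_1,\dots,x_n$ in $b$ such that $\|Q_{x_i}\psi\|\le\varepsilon$ for all $i=1,\dots,n$. Then $\psi\in H^{(1)}$, that is, $Q_{x\vee y}\psi=Q_x\psi+Q_y\psi$ for all $x,y\in B$ with $x\wedge y=0$.
   Context: $(\Omega,\mathcal F,P)$ is a complete probability space with $L_2(\Omega,\mathcal F,P)$ separable (real or complex scalars). $\Lambda$ denotes the set of all sub-$\sigma$-fields of $\mathcal F$ containing all $P$-null sets, ordered by inclusion; it is a lattice with $x\wedge y=x\cap y$ and $x\vee y$ the $\sigma$-field generated by $x\cup y$; its least element $0$ is the $\sigma$-field of all events of probability $0$ or $1$, its greatest element is $1=\mathcal F$. A noise-type Boolean algebra (of $\sigma$-fields on $(\Omega,\mathcal F,P)$) is a distributive sublattice $B\subset\Lambda$ (operations $\wedge,\vee$ of $\Lambda$) containing $0$ and $1$, in which every $x\in B$ has a complement $x'\in B$ ($x\wedge x'=0$, $x\vee x'=1$), and such that for every $x\in B$ the $\sigma$-fields $x$ and $x'$ are independent. For $x\in\Lambda$, $Q_x$ is the orthogonal projection of $H=L_2(\Omega,\mathcal F,P)$ onto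 the subspace of functions measurable with respect to the $\sigma$-field $x$ (conditional expectation given $x$). A partition of unity in $b$ is a finite family $x_1,\dots,x_n\in b$ with $x_1\vee\dots\vee x_n=1$, $x_i\ne0$ for all $i$, and $x_i\wedge x_j=0$ for $i\ne j$. The first chaos space $H^{(1)}$ of $B$ is the set of all $\psi\in H$ such that for all $x,y\in B$, $x\wedge y=0$ implies $Q_{x\vee y}\psi=Q_x\psi+Q_y\psi$. *)

theory Defs
  imports "HOL-Probability.Probability"
begin

text \<open>
  The scalar type is any \<^typ>\<open>'a::{real_normed_field, euclidean_space}\<close>: a finite-dimensional
  real normed field, hence real or complex. Elements of \<open>L\<^sub>2\<close> are represented by functions,
  equality in \<open>L\<^sub>2\<close> by equality almost everywhere. Sigma-fields are represented by their
  sets of events.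
\<close>

definition L2 :: "'w measure \<Rightarrow> ('w \<Rightarrow> 'a::{real_normed_field, euclidean_space}) set" where
  "L2 M = {f \<in> borel_measurable M. integrable M (\<lambda>\<omega>. (norm (f \<omega>))\<^sup>2)}"

definition L2_norm :: "'w measure \<Rightarrow> ('w \<Rightarrow> 'a::{real_normed_field, euclidean_space}) \<Rightarrow> real" where
  "L2_norm M f = sqrt (LINT \<omega>|M. (norm (f \<omega>))\<^sup>2)"

definition L2_dense :: "'w measure \<Rightarrow> ('w \<Rightarrow> 'a::{real_normed_field, euclidean_space}) set \<Rightarrow> bool" where
  "L2_dense M D \<longleftrightarrow>
     D \<subseteq> L2 M \<and> (\<forall>f\<in>L2 M. \<forall>e>0. \<exists>d\<in>D. L2_norm M (\<lambda>\<omega>. f \<omega> - d \<omega>) < e)"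

definition subfields :: "'w measure \<Rightarrow> 'w set set set" where
  "subfields M = {x. sigma_algebra (space M) x \<and> x \<subseteq> sets M \<and> null_sets M \<subseteq> x}"

definition sigma_join :: "'w measure \<Rightarrow> 'w set set \<Rightarrow> 'w set set \<Rightarrow> 'w set set" where
  "sigma_join M x y = sigma_sets (space M) (x \<union> y)"

definition trivial_field :: "'w measure \<Rightarrow> 'w set set" where
  "trivial_field M = {A \<in> sets M. measure M A = 0 \<or> measure M A = 1}"

definition complementary :: "'w measure \<Rightarrow> 'w set set \<Rightarrow> 'w set set \<Rightarrow> bool" where
  "complementary M x x' \<longleftrightarrow> x \<inter> x' = trivial_field M \<and> sigma_join M x x' = sets M"

definition noise_type_boolean_algebra :: "'w measure \<Rightarrow> 'w set set set \<Rightarrow> bool" where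
  "noise_type_boolean_algebra M B \<longleftrightarrow>
     B \<subseteq> subfields M \<and> trivial_field M \<in> B \<and> sets M \<in> B \<and>
     (\<forall>x\<in>B. \<forall>y\<in>B. x \<inter> y \<in> B \<and> sigma_join M x y \<in> B) \<and>
     (\<forall>x\<in>B. \<forall>y\<in>B. \<forall>z\<in>B. x \<inter> sigma_join M y z = sigma_join M (x \<inter> y) (x \<inter> z)) \<and>
     (\<forall>x\<in>B. \<exists>x'\<in>B. complementary M x x') \<and>
     (\<forall>x\<in>B. \<forall>x'\<in>B. complementary M x x' \<longrightarrow> prob_space.indep_set M x x')"

definition boolean_subalgebra :: "'w measure \<Rightarrow> 'w set set set \<Rightarrow> 'w set set set \<Rightarrow> bool" where
  "boolean_subalgebra M b B \<longleftrightarrow>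
     b \<subseteq> B \<and> trivial_field M \<in> b \<and> sets M \<in> b \<and>
     (\<forall>x\<in>b. \<forall>y\<in>b. x \<inter> y \<in> b \<and> sigma_join M x y \<in> b) \<and>
     (\<forall>x\<in>b. \<forall>x'\<in>B. complementary M x x' \<longrightarrow> x' \<in> b)"

definition L2_sub :: "'w measure \<Rightarrow> 'w set set \<Rightarrow> ('w \<Rightarrow> 'a::{real_normed_field, euclidean_space}) set" where
  "L2_sub M x = {f \<in> L2 M. f \<in> borel_measurable (sigma (space M) x)}"

text \<open>
  Orthogonal projection onto \<^term>\<open>L2_sub M x\<close>, determined up to equality almost everywhere.
  For complex scalars the inner product of the type is the real part of the Hermitian one;
  as \<^term>\<open>L2_sub M x\<close> is closed under multiplication by scalars, orthogonality to it means
  the same for both.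
\<close>

definition Q :: "'w measure \<Rightarrow> 'w set set \<Rightarrow> ('w \<Rightarrow> 'a) \<Rightarrow> 'w \<Rightarrow> 'a::{real_normed_field, euclidean_space}" where
  "Q M x f = (SOME g. g \<in> L2_sub M x \<and>
     (\<forall>h\<in>L2_sub M x. (LINT \<omega>|M. (f \<omega> - g \<omega>) \<bullet> h \<omega>) = 0))"

definition partition_of_unity ::
  "'w measure \<Rightarrow> 'w set set set \<Rightarrow> nat \<Rightarrow> (nat \<Rightarrow> 'w set set) \<Rightarrow> bool" where
  "partition_of_unity M b n x \<longleftrightarrow>
     1 \<le> n \<and> (\<forall>i\<in>{1..n}. x i \<in> b \<and> x i \<noteq> trivial_field M) \<and>
     sigma_sets (space M) (\<Union>i\<in>{1..n}. x i) = sets M \<and>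
     (\<forall>i\<in>{1..n}. \<forall>j\<in>{1..n}. i \<noteq> j \<longrightarrow> x i \<inter> x j = trivial_field M)"

definition atomless ::
  "'w measure \<Rightarrow> 'w set set set \<Rightarrow> ('w \<Rightarrow> 'a::{real_normed_field, euclidean_space}) \<Rightarrow> bool" where
  "atomless M b \<psi> \<longleftrightarrow>
     (\<forall>\<epsilon>>0. \<exists>n x. partition_of_unity M b n x \<and> (\<forall>i\<in>{1..n}. L2_norm M (Q M (x i) \<psi>) \<le> \<epsilon>))"

definition first_chaos ::
  "'w measure \<Rightarrow> 'w set set set \<Rightarrow> ('w \<Rightarrow> 'a::{real_normed_field, euclidean_space}) set" where
  "first_chaos M B = {\<psi> \<in> L2 M. \<forall>x\<in>B. \<forall>y\<in>B. x \<inter> y = trivial_field M \<longrightarrow>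
     (AE \<omega> in M. Q M (sigma_join M x y) \<psi> \<omega> = Q M x \<psi> \<omega> + Q M y \<psi> \<omega>)}"

end

theory Submission
  imports Defs
begin

text \<open>
  Fix disjoint \<open>x, y \<in> B\<close> and let \<open>x'\<close> be a complement of \<open>x\<close>, so \<open>y \<subseteq> x'\<close>. The part of \<open>\<psi>\<close> that must
  vanish is a bilinear form \<open>(f, g) \<mapsto> E(\<psi> f g)\<close> on centred functions \<open>f\<close> of \<open>x\<close> and \<open>g\<close> of \<open>x'\<close>.
  For a partition of unity \<open>z i\<close> in \<open>b\<close>, (i) gives \<open>\<psi> = (\<Sum>i. \<psi> i)\<close> with \<open>\<psi> i = E(\<psi> | z i)\<close>, and
  \<open>E(\<psi> i f g) = E(\<psi> i f i g i)\<close> with \<open>f i = E(f | x \<inter> z i)\<close> and \<open>g i = E(g | x' \<inter> z i)\<close>: the form is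
  block diagonal, so its operator norm is at most the largest of the norms of the \<open>\<psi> i\<close>, which
  by (ii) is arbitrarily small. Hence \<open>E(\<psi> f g) = 0\<close>, which for centred indicators is the
  required identity on the generating rectangles of \<open>x \<or> y\<close>.
\<close>

section \<open>Products of square integrable real functions and the Cauchy-Schwarz
  inequality\<close>

lemma integrable_mult_square_integrable:
  fixes u v :: "'w \<Rightarrow> real"
  assumes [measurable]: "u \<in> borel_measurable M" "v \<in> borel_measurable M"
    and "integrable M (\<lambda>\<omega>. (u \<omega>)\<^sup>2)" "integrable M (\<lambda>\<omega>. (v \<omega>)\<^sup>2)"
  shows "integrable M (\<lambda>\<omega>. u \<omega> * v \<omega>)"
proof (rule Bochner_Integration.integrable_bound)
  show "integrable M (\<lambda>\<omega>. (u \<omega>)\<^sup>2 + (v \<omega>)\<^sup>2)" using assms by simp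
  have "\<bar>a * b\<bar> \<le> \<bar>a\<^sup>2 + b\<^sup>2\<bar>" for a b :: real
    using sum_squares_bound[of "\<bar>a\<bar>" "\<bar>b\<bar>"] mult_nonneg_nonneg[of "\<bar>a\<bar>" "\<bar>b\<bar>"]
    by (simp add: abs_mult mult.assoc del: mult_nonneg_nonneg)
  then show "AE \<omega> in M. norm (u \<omega> * v \<omega>) \<le> norm ((u \<omega>)\<^sup>2 + (v \<omega>)\<^sup>2)"
    by (simp del: abs_of_nonneg)
qed simp

lemma Cauchy_Schwarz_lebesgue_integral:
  fixes u v :: "'w \<Rightarrow> real"
  assumes [measurable]: "u \<in> borel_measurable M" "v \<in> borel_measurable M"
    and u2: "integrable M (\<lambda>\<omega>. (u \<omega>)\<^sup>2)" and v2: "integrable M (\<lambda>\<omega>. (v \<omega>)\<^sup>2)"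
  shows "(\<integral>\<omega>. u \<omega> * v \<omega> \<partial>M)\<^sup>2 \<le> (\<integral>\<omega>. (u \<omega>)\<^sup>2 \<partial>M) * (\<integral>\<omega>. (v \<omega>)\<^sup>2 \<partial>M)"
proof -
  define a b c where "a = (\<integral>\<omega>. (u \<omega>)\<^sup>2 \<partial>M)" and "b = (\<integral>\<omega>. u \<omega> * v \<omega> \<partial>M)"
    and "c = (\<integral>\<omega>. (v \<omega>)\<^sup>2 \<partial>M)"
  have uv: "integrable M (\<lambda>\<omega>. u \<omega> * v \<omega>)"
    by (rule integrable_mult_square_integrable) fact+
  have c0: "0 \<le> c" unfolding c_def by simp
  show ?thesis
  \<comment> \<open>If \<open>c = 0\<close>, then \<open>v\<close> vanishes almost everywhere and so
    \<open>b = 0\<close>. Otherwise the nonnegative integral of the square of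
    \<open>c * u \<omega> - b * v \<omega>\<close> equals \<open>c * (a * c - b\<^sup>2)\<close>,
    and \<open>c > 0\<close> can be divided out.\<close>
  proof (cases "c = 0")
    case True
    have "AE \<omega> in M. (v \<omega>)\<^sup>2 = 0"
      using True v2 unfolding c_def by (subst (asm) integral_nonneg_eq_0_iff_AE) auto
    then have "b = (\<integral>\<omega>. 0 \<partial>M)"
      unfolding b_def by (intro integral_cong_AE) auto
    then show ?thesis using c0 by (simp flip: a_def b_def c_def add: True)
  next
    case False
    have "0 \<le> (\<integral>\<omega>. (c * u \<omega> - b * v \<omega>)\<^sup>2 \<partial>M)" by simp
    also have "\<dots> = (\<integral>\<omega>. c\<^sup>2 * (u \<omega>)\<^sup>2 + b\<^sup>2 * (v \<omega>)\<^sup>2 - 2 * c * b * (u \<omega> * v \<omega>) \<partial>M)"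
      by (simp add: power2_diff power_mult_distrib mult_ac)
    also have "\<dots> = c\<^sup>2 * a + b\<^sup>2 * c - 2 * c * b * b"
      using u2 v2 uv unfolding a_def b_def c_def by simp
    also have "\<dots> = c * (a * c - b\<^sup>2)" by (simp add: power2_eq_square algebra_simps)
    finally have "b\<^sup>2 \<le> a * c"
      using False c0 by (simp add: zero_le_mult_iff)
    then show ?thesis by (simp add: a_def b_def c_def)
  qed
qed

section \<open>Independence, conditional expectation in L2, and integrals over a join\<close>

context prob_space
begin

lemma indep_set_mono:
  assumes "indep_set A B" "A' \<subseteq> A" "B' \<subseteq> B"
  shows "indep_set A' B'"
  using assms unfolding indep_sets2_eq by blast

text \<open>Preimages of Borel sets under \<open>f\<close> and \<open>g\<close> lie in
  \<open>F\<close> and \<open>G\<close>, so the sigma-fields generated by the two functions inherit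
  independence. This opens the way to the product rule for expectations.\<close>

lemma indep_var_of_indep_set:
  fixes f g :: "'a \<Rightarrow> real"
  assumes ind: "indep_set (sets F) (sets G)"
    and F: "subalgebra M F" "f \<in> borel_measurable F"
    and G: "subalgebra M G" "g \<in> borel_measurable G"
  shows "indep_var borel f borel g"
proof -
  have sub: "sigma_sets (space M) {h -` A \<inter> space M |A. A \<in> sets borel} \<subseteq> sets H"
    if H: "subalgebra M H" "h \<in> borel_measurable H" for H and h :: "'a \<Rightarrow> real"
  proof -
    have sp: "space H = space M" using H(1) by (simp add: subalgebra_def)
    have "{h -` A \<inter> space H |A. A \<in> sets borel} \<subseteq> sets H"
      using measurable_sets[OF H(2)] by blast
    from sets.sigma_sets_subset[OF this] show ?thesis unfolding sp .
  qed
  show ?thesis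
    unfolding indep_var_eq
    using indep_set_mono[OF ind sub[OF F] sub[OF G]]
      measurable_from_subalg[OF F] measurable_from_subalg[OF G] by simp
qed

lemma indep_set_integral_mult:
  fixes f g :: "'a \<Rightarrow> real"
  assumes "indep_set (sets F) (sets G)" "subalgebra M F" "f \<in> borel_measurable F"
    and "subalgebra M G" "g \<in> borel_measurable G" and "integrable M f" "integrable M g"
  shows "(\<integral>\<omega>. f \<omega> * g \<omega> \<partial>M) = (\<integral>\<omega>. f \<omega> \<partial>M) * (\<integral>\<omega>. g \<omega> \<partial>M)"
    and "integrable M (\<lambda>\<omega>. f \<omega> * g \<omega>)"
proof -
  have "indep_var borel f borel g"
    by (rule indep_var_of_indep_set) fact+
  then show "(\<integral>\<omega>. f \<omega> * g \<omega> \<partial>M) = (\<integral>\<omega>. f \<omega> \<partial>M) * (\<integral>\<omega>. g \<omega> \<partial>M)"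
    "integrable M (\<lambda>\<omega>. f \<omega> * g \<omega>)"
    using assms by (auto intro: indep_var_lebesgue_integral indep_var_integrable)
qed

lemma finite_measure_subalgebraI: "subalgebra M F \<Longrightarrow> finite_measure_subalgebra M F"
  by (simp add: finite_measure_subalgebra_def finite_measure_subalgebra_axioms_def
      finite_measure_axioms)

lemma sigma_finite_subalgebraI: "subalgebra M F \<Longrightarrow> sigma_finite_subalgebra M F"
  by (intro finite_measure_subalgebra_is_sigma_finite finite_measure_subalgebraI)

text \<open>Conditional Jensen inequality for the convex function "square".\<close>

lemma integrable_real_cond_exp_square:
  assumes F: "subalgebra M F"
    and f: "f \<in> borel_measurable M" "integrable M (\<lambda>\<omega>. (f \<omega>)\<^sup>2)"
  shows "integrable M (\<lambda>\<omega>. (real_cond_exp M F f \<omega>)\<^sup>2)"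
proof -
  interpret sigma_finite_subalgebra M F by (rule sigma_finite_subalgebraI) fact
  show ?thesis
    by (rule integrable_convex_cond_exp[where I = UNIV])
      (use f square_integrable_imp_integrable convex_power2 in auto)
qed

text \<open>The conditional expectations of a centred function on pairwise independent sigma-fields
  are centred and independent, hence pairwise orthogonal, and each is an orthogonal projection of
  \<open>f\<close>. Bessel's inequality is then the nonnegativity of the squared distance from
  \<open>f\<close> to their sum. Centring matters: a nonzero mean would be a component common to all
  the projections.\<close>

lemma real_cond_exp_bessel:
  fixes f :: "'a \<Rightarrow> real"
  assumes "finite I" and F: "\<And>i. i \<in> I \<Longrightarrow> subalgebra M (F i)"
    and ind: "\<And>i j. i \<in> I \<Longrightarrow> j \<in> I \<Longrightarrow> i \<noteq> j \<Longrightarrow> indep_set (sets (F i)) (sets (F j))"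
    and f[measurable]: "f \<in> borel_measurable M" and f2: "integrable M (\<lambda>\<omega>. (f \<omega>)\<^sup>2)"
    and f0: "(\<integral>\<omega>. f \<omega> \<partial>M) = 0"
  shows "(\<Sum>i\<in>I. \<integral>\<omega>. (real_cond_exp M (F i) f \<omega>)\<^sup>2 \<partial>M) \<le> (\<integral>\<omega>. (f \<omega>)\<^sup>2 \<partial>M)"
proof -
  define e where "e i = real_cond_exp M (F i) f" for i
  have f1: "integrable M f" using f f2 by (rule square_integrable_imp_integrable)
  have [measurable]: "e i \<in> borel_measurable M" for i unfolding e_def by simp
  have e2: "integrable M (\<lambda>\<omega>. (e i \<omega>)\<^sup>2)" if "i \<in> I" for i
    unfolding e_def using F[OF that] f f2 by (rule integrable_real_cond_exp_square)
  have ef: "integrable M (\<lambda>\<omega>. e i \<omega> * f \<omega>)" if "i \<in> I" for i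
    using e2[OF that] f2 by (intro integrable_mult_square_integrable) auto
  have ee: "integrable M (\<lambda>\<omega>. e i \<omega> * e j \<omega>)" if "i \<in> I" "j \<in> I" for i j
    using e2 that by (intro integrable_mult_square_integrable) auto
  \<comment> \<open>\<open>e i\<close> is measurable for \<open>F i\<close>, so \<open>f\<close> may
    be replaced by its conditional expectation \<open>e i\<close> under the integral.\<close>
  have ef_eq: "(\<integral>\<omega>. e i \<omega> * f \<omega> \<partial>M) = (\<integral>\<omega>. (e i \<omega>)\<^sup>2 \<partial>M)" if "i \<in> I" for i
  proof -
    interpret sigma_finite_subalgebra M "F i" by (rule sigma_finite_subalgebraI[OF F[OF that]])
    show ?thesis
      using real_cond_exp_intg(2)[of "e i" f] ef[OF that] unfolding e_def
      by (simp add: power2_eq_square)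
  qed
  have ee_eq: "(\<integral>\<omega>. e i \<omega> * e j \<omega> \<partial>M) = (if i = j then \<integral>\<omega>. (e i \<omega>)\<^sup>2 \<partial>M else 0)"
    if ij: "i \<in> I" "j \<in> I" for i j
  proof (cases "i = j")
    case False
    interpret i: sigma_finite_subalgebra M "F i" by (rule sigma_finite_subalgebraI[OF F[OF ij(1)]])
    interpret j: sigma_finite_subalgebra M "F j" by (rule sigma_finite_subalgebraI[OF F[OF ij(2)]])
    have "(\<integral>\<omega>. e i \<omega> * e j \<omega> \<partial>M) = (\<integral>\<omega>. e i \<omega> \<partial>M) * (\<integral>\<omega>. e j \<omega> \<partial>M)"
      by (rule indep_set_integral_mult[OF ind[OF ij False] F[OF ij(1)] _ F[OF ij(2)]])
        (auto simp: e_def f1)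
    also have "(\<integral>\<omega>. e i \<omega> \<partial>M) = 0"
      unfolding e_def using i.real_cond_exp_int(2)[OF f1] f0 by simp
    finally show ?thesis using False by simp
  qed (simp add: power2_eq_square)
  have "0 \<le> (\<integral>\<omega>. (f \<omega> - (\<Sum>i\<in>I. e i \<omega>))\<^sup>2 \<partial>M)" by simp
  also have "\<dots> = (\<integral>\<omega>. (f \<omega>)\<^sup>2 - 2 * (\<Sum>i\<in>I. e i \<omega> * f \<omega>) + (\<Sum>i\<in>I. \<Sum>j\<in>I. e i \<omega> * e j \<omega>) \<partial>M)"
    by (simp add: power2_diff power2_eq_square sum_product sum_distrib_left sum_distrib_right algebra_simps)
  also have "\<dots> = (\<integral>\<omega>. (f \<omega>)\<^sup>2 \<partial>M) - 2 * (\<Sum>i\<in>I. \<integral>\<omega>. (e i \<omega>)\<^sup>2 \<partial>M)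
      + (\<Sum>i\<in>I. \<Sum>j\<in>I. if i = j then \<integral>\<omega>. (e i \<omega>)\<^sup>2 \<partial>M else 0)"
    using f2 ef ee by (simp add: ef_eq ee_eq cong: sum.cong)
  also have "\<dots> = (\<integral>\<omega>. (f \<omega>)\<^sup>2 \<partial>M) - (\<Sum>i\<in>I. \<integral>\<omega>. (e i \<omega>)\<^sup>2 \<partial>M)"
    using \<open>finite I\<close> by simp
  finally show ?thesis unfolding e_def by simp
qed

text \<open>The rectangles \<open>A \<inter> B\<close> form a pi-system that generates the join, and
  the events on which the two integrals agree are closed under complements and countable disjoint
  unions, so Dynkin's theorem applies.\<close>

lemma set_integral_sigma_join_eqI:
  fixes f g :: "'a \<Rightarrow> real"
  assumes x: "sigma_algebra (space M) x" "x \<subseteq> sets M"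
    and y: "sigma_algebra (space M) y" "y \<subseteq> sets M"
    and f[measurable]: "integrable M f" and g[measurable]: "integrable M g"
    and rect: "\<And>A B. A \<in> x \<Longrightarrow> B \<in> y \<Longrightarrow>
      (\<integral>\<omega>\<in>A \<inter> B. f \<omega> \<partial>M) = (\<integral>\<omega>\<in>A \<inter> B. g \<omega> \<partial>M)"
    and C: "C \<in> sigma_join M x y"
  shows "(\<integral>\<omega>\<in>C. f \<omega> \<partial>M) = (\<integral>\<omega>\<in>C. g \<omega> \<partial>M)"
proof -
  interpret x: sigma_algebra "space M" x by fact
  interpret y: sigma_algebra "space M" y by fact
  define R where "R = {A \<inter> B | A B. A \<in> x \<and> B \<in> y}"
  have RM: "R \<subseteq> sets M" using x y unfolding R_def by blast
  then have Rsub: "R \<subseteq> Pow (space M)" using sets.sets_into_space by blast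
  \<comment> \<open>An event of either field is a rectangle whose other side is the whole
    space.\<close>
  have "x \<union> y \<subseteq> R"
  proof
    fix A assume A: "A \<in> x \<union> y"
    then have "A = A \<inter> space M" "A = space M \<inter> A"
      using x.sets_into_space y.sets_into_space by auto
    with A show "A \<in> R" unfolding R_def using x.top y.top by (metis (mono_tags, lifting) UnE mem_Collect_eq)
  qed
  then have CR: "C \<in> sigma_sets (space M) R"
    using C sigma_sets_mono' unfolding sigma_join_def by blast
  have "Int_stable R"
  proof (rule Int_stableI)
    fix a b assume "a \<in> R" "b \<in> R"
    then obtain A B A' B' where "a = A \<inter> B" "b = A' \<inter> B'" "A \<in> x" "A' \<in> x" "B \<in> y" "B' \<in> y"
      unfolding R_def by blast
    then have "a \<inter> b = (A \<inter> A') \<inter> (B \<inter> B')" "A \<inter> A' \<in> x" "B \<inter> B' \<in> y" by auto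
    then show "a \<inter> b \<in> R" unfolding R_def by blast
  qed
  have meas: "A \<in> sets M" if "A \<in> sigma_sets (space M) R" for A
    using that RM sets.sigma_sets_subset by blast
  \<comment> \<open>The whole space is itself a rectangle; the complement step subtracts from this
    integral.\<close>
  have space: "(\<integral>\<omega>\<in>space M. f \<omega> \<partial>M) = (\<integral>\<omega>\<in>space M. g \<omega> \<partial>M)"
    using rect[OF x.top y.top] by simp
  show ?thesis
    using \<open>Int_stable R\<close> Rsub CR
  proof (induction rule: sigma_sets_induct_disjoint)
    case (basic A)
    then show ?case using rect unfolding R_def by blast
  next
    case empty
    then show ?case by (simp add: set_lebesgue_integral_def)
  next
    case (compl A)
    have diff: "(\<integral>\<omega>\<in>space M - A. h \<omega> \<partial>M) = (\<integral>\<omega>\<in>space M. h \<omega> \<partial>M) - (\<integral>\<omega>\<in>A. h \<omega> \<partial>M)"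
      if h: "integrable M h" for h :: "'a \<Rightarrow> real"
    proof -
      have "set_integrable M B h" if "B \<in> sets M" for B
        using integrable_mult_indicator[OF that h] by (simp add: set_integrable_def)
      then have "(\<integral>\<omega>\<in>A \<union> (space M - A). h \<omega> \<partial>M)
          = (\<integral>\<omega>\<in>A. h \<omega> \<partial>M) + (\<integral>\<omega>\<in>space M - A. h \<omega> \<partial>M)"
        using meas[OF compl(1)] by (intro set_integral_Un) auto
      moreover have "A \<union> (space M - A) = space M"
        using meas[OF compl(1)] sets.sets_into_space by blast
      ultimately show ?thesis by simp
    qed
    show ?case using diff[OF f] diff[OF g] compl(2) space by simp
  next
    case (union A)
    have count: "(\<integral>\<omega>\<in>(\<Union>i. A i). h \<omega> \<partial>M) = (\<Sum>i. \<integral>\<omega>\<in>A i. h \<omega> \<partial>M)"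
      if h: "integrable M h" for h :: "'a \<Rightarrow> real"
    proof (rule lebesgue_integral_countable_add)
      show A: "A i \<in> sets M" for i using union(2) meas by blast
      show "A i \<inter> A j = {}" if "i \<noteq> j" for i j
        using union(1) that unfolding disjoint_family_on_def by blast
      have "(\<Union>i. A i) \<in> sets M" using A by blast
      then show "set_integrable M (\<Union>i. A i) h"
        using integrable_mult_indicator h unfolding set_integrable_def by blast
    qed
    show ?case unfolding count[OF f] count[OF g] using union(3) by simp
  qed
qed

end

section \<open>Sub-sigma-fields, their joins, and conditional expectation on a join\<close>

text \<open>\<open>sigma (space M) x\<close> turns a set of events into the measurable space that
  \<open>real_cond_exp\<close> expects; the probability itself is taken from
  \<open>M\<close>.\<close>

abbreviation cond_exp :: "'w measure \<Rightarrow> 'w set set \<Rightarrow> ('w \<Rightarrow> real) \<Rightarrow> 'w \<Rightarrow> real" where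
  "cond_exp M x f \<equiv> real_cond_exp M (sigma (space M) x) f"

lemma subfieldsD:
  assumes "x \<in> subfields M"
  shows "sigma_algebra (space M) x" "x \<subseteq> sets M" "null_sets M \<subseteq> x"
  using assms by (auto simp: subfields_def)

lemma sets_sigma_subfield: "x \<in> subfields M \<Longrightarrow> sets (sigma (space M) x) = x"
  by (simp add: subfields_def sigma_algebra.sets_measure_of_eq)

lemma subalgebra_sigma_subfield: "x \<in> subfields M \<Longrightarrow> subalgebra M (sigma (space M) x)"
  unfolding subalgebra_def
  by (simp add: sets_sigma_subfield subfieldsD space_measure_of_conv)

lemma borel_measurable_sigma_subfield_mono:
  assumes "x \<subseteq> y" "x \<in> subfields M" "y \<in> subfields M" "f \<in> borel_measurable (sigma (space M) x)"
  shows "f \<in> borel_measurable (sigma (space M) y)"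
  using assms measurable_mono[of borel borel "sigma (space M) x" "sigma (space M) y"]
  by (auto simp: sets_sigma_subfield space_measure_of_conv)

lemma sigma_join_upper1: "x \<subseteq> sigma_join M x y"
  and sigma_join_upper2: "y \<subseteq> sigma_join M x y"
  unfolding sigma_join_def by auto

lemma sigma_join_in_subfields:
  assumes "x \<in> subfields M" "y \<in> subfields M"
  shows "sigma_join M x y \<in> subfields M"
proof -
  have xy: "x \<union> y \<subseteq> sets M" using assms by (auto simp: subfields_def)
  then have "x \<union> y \<subseteq> Pow (space M)" using sets.space_closed by blast
  then have "sigma_algebra (space M) (sigma_join M x y)"
    unfolding sigma_join_def by (rule sigma_algebra_sigma_sets)
  moreover have "sigma_join M x y \<subseteq> sets M"
    unfolding sigma_join_def using xy by (rule sets.sigma_sets_subset)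
  moreover have "null_sets M \<subseteq> sigma_join M x y"
    using subfieldsD(3)[OF assms(1)] sigma_join_upper1 by blast
  ultimately show ?thesis by (simp add: subfields_def)
qed

lemma sigma_join_absorb:
  assumes "x \<subseteq> y" "y \<in> subfields M"
  shows "sigma_join M x y = y"
  using assms unfolding sigma_join_def
  by (simp add: Un_absorb1 subfieldsD sigma_algebra.sigma_sets_eq)

text \<open>An event of probability 1 is the complement of a null set, and every element of
  \<open>subfields M\<close> contains all null sets. Thus the trivial field is the least element of
  the lattice.\<close>

lemma (in prob_space) trivial_field_subset:
  assumes "x \<in> subfields M"
  shows "trivial_field M \<subseteq> x"
proof
  interpret x: sigma_algebra "space M" x using assms by (rule subfieldsD)
  fix A assume A: "A \<in> trivial_field M"
  then have AM: "A \<in> sets M" by (simp add: trivial_field_def)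
  consider "measure M A = 0" | "measure M A = 1" using A by (auto simp: trivial_field_def)
  then show "A \<in> x"
  proof cases
    case 1
    then have "A \<in> null_sets M" using AM by (simp add: null_sets_def emeasure_eq_measure)
    then show ?thesis using subfieldsD(3)[OF assms] by blast
  next
    case 2
    then have "space M - A \<in> null_sets M"
      using AM by (simp add: null_sets_def emeasure_eq_measure prob_compl)
    then have "space M - (space M - A) \<in> x" using subfieldsD(3)[OF assms] by blast
    moreover have "space M - (space M - A) = A" using sets.sets_into_space[OF AM] by blast
    ultimately show ?thesis by simp
  qed
qed

context prob_space
begin

text \<open>Integrals over rectangles determine those over all events of the join, so they suffice
  to recognise a conditional expectation. Both the product formula below and the final additivity
  are checked in this way.\<close>

lemma cond_exp_sigma_join_charact:
  assumes x: "x \<in> subfields M" and y: "y \<in> subfields M"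
    and f: "integrable M f" and g: "integrable M g"
    and gm: "g \<in> borel_measurable (sigma (space M) (sigma_join M x y))"
    and rect: "\<And>A B. A \<in> x \<Longrightarrow> B \<in> y \<Longrightarrow>
      (\<integral>\<omega>\<in>A \<inter> B. f \<omega> \<partial>M) = (\<integral>\<omega>\<in>A \<inter> B. g \<omega> \<partial>M)"
  shows "AE \<omega> in M. cond_exp M (sigma_join M x y) f \<omega> = g \<omega>"
proof -
  have j: "sigma_join M x y \<in> subfields M" using x y by (rule sigma_join_in_subfields)
  interpret sigma_finite_subalgebra M "sigma (space M) (sigma_join M x y)"
    by (rule sigma_finite_subalgebraI[OF subalgebra_sigma_subfield[OF j]])
  show ?thesis
  proof (rule real_cond_exp_charact)
    fix C assume "C \<in> sets (sigma (space M) (sigma_join M x y))"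
    then have "C \<in> sigma_join M x y" by (simp add: sets_sigma_subfield[OF j])
    then show "(\<integral>\<omega>\<in>C. f \<omega> \<partial>M) = (\<integral>\<omega>\<in>C. g \<omega> \<partial>M)"
      using set_integral_sigma_join_eqI[OF _ _ _ _ f g rect] x y subfieldsD by blast
  qed (use f g gm in auto)
qed

text \<open>On a rectangle the integral of \<open>f \<omega> * g \<omega>\<close> factorises by
  independence of \<open>x\<close> and \<open>y\<close>. Each factor is unchanged when its function
  is replaced by the conditional expectation on \<open>u\<close> or \<open>v\<close>, and
  independence joins the factors again, since these conditional expectations are still measurable
  for \<open>x\<close> and \<open>y\<close>.\<close>

lemma cond_exp_mult_indep:
  assumes x: "x \<in> subfields M" and y: "y \<in> subfields M" and ind: "indep_set x y"
    and u: "u \<in> subfields M" "u \<subseteq> x" and v: "v \<in> subfields M" "v \<subseteq> y"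
    and f: "f \<in> borel_measurable (sigma (space M) x)" "integrable M f"
    and g: "g \<in> borel_measurable (sigma (space M) y)" "integrable M g"
  shows "AE \<omega> in M. cond_exp M (sigma_join M u v) (\<lambda>\<omega>. f \<omega> * g \<omega>) \<omega>
    = cond_exp M u f \<omega> * cond_exp M v g \<omega>"
proof (rule cond_exp_sigma_join_charact)
  note sub = subalgebra_sigma_subfield
  note im = indep_set_integral_mult[OF _ sub[OF x] _ sub[OF y]]
  have ind': "indep_set (sets (sigma (space M) x)) (sets (sigma (space M) y))"
    using ind by (simp add: sets_sigma_subfield x y)
  interpret u: sigma_finite_subalgebra M "sigma (space M) u"
    by (rule sigma_finite_subalgebraI[OF sub[OF u(1)]])
  interpret v: sigma_finite_subalgebra M "sigma (space M) v"
    by (rule sigma_finite_subalgebraI[OF sub[OF v(1)]])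
  have cu: "cond_exp M u f \<in> borel_measurable (sigma (space M) x)"
    by (rule borel_measurable_sigma_subfield_mono[OF u(2,1) x borel_measurable_cond_exp])
  have cv: "cond_exp M v g \<in> borel_measurable (sigma (space M) y)"
    by (rule borel_measurable_sigma_subfield_mono[OF v(2,1) y borel_measurable_cond_exp])
  show "integrable M (\<lambda>\<omega>. f \<omega> * g \<omega>)"
    using im(2)[OF ind' f(1) g(1)] f g by simp
  show "integrable M (\<lambda>\<omega>. cond_exp M u f \<omega> * cond_exp M v g \<omega>)"
    using im(2)[OF ind' cu cv] f g u.real_cond_exp_int v.real_cond_exp_int by blast
  have uv: "sigma_join M u v \<in> subfields M" using u v sigma_join_in_subfields by blast
  have "cond_exp M u f \<in> borel_measurable (sigma (space M) (sigma_join M u v))"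
    by (rule borel_measurable_sigma_subfield_mono[OF sigma_join_upper1 u(1) uv borel_measurable_cond_exp])
  moreover have "cond_exp M v g \<in> borel_measurable (sigma (space M) (sigma_join M u v))"
    by (rule borel_measurable_sigma_subfield_mono[OF sigma_join_upper2 v(1) uv borel_measurable_cond_exp])
  ultimately show "(\<lambda>\<omega>. cond_exp M u f \<omega> * cond_exp M v g \<omega>)
      \<in> borel_measurable (sigma (space M) (sigma_join M u v))" by simp
  fix A B assume A: "A \<in> u" and B: "B \<in> v"
  have AM: "A \<in> sets M" and BM: "B \<in> sets M" using A B u v subfieldsD(2) by blast+
  \<comment> \<open>Stated for general \<open>h\<close> and \<open>k\<close> because it is used
    twice: forwards for \<open>f\<close> and \<open>g\<close>, backwards for their conditional
    expectations.\<close>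
  have AB: "(\<integral>\<omega>\<in>A \<inter> B. h \<omega> * k \<omega> \<partial>M) = (\<integral>\<omega>\<in>A. h \<omega> \<partial>M) * (\<integral>\<omega>\<in>B. k \<omega> \<partial>M)"
    if h: "h \<in> borel_measurable (sigma (space M) x)" "integrable M h"
      and k: "k \<in> borel_measurable (sigma (space M) y)" "integrable M k"
    for h k :: "'a \<Rightarrow> real"
  proof -
    have "A \<in> sets (sigma (space M) x)" "B \<in> sets (sigma (space M) y)"
      using A B u v by (auto simp: sets_sigma_subfield x y)
    then have "(\<lambda>\<omega>. indicator A \<omega> * h \<omega>) \<in> borel_measurable (sigma (space M) x)"
      "(\<lambda>\<omega>. indicator B \<omega> * k \<omega>) \<in> borel_measurable (sigma (space M) y)"
      using h k by simp_all
    from im(1)[OF ind' this] integrable_mult_indicator[OF AM h(2)] integrable_mult_indicator[OF BM k(2)]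
    show ?thesis by (simp add: set_lebesgue_integral_def indicator_inter_arith mult_ac)
  qed
  have "(\<integral>\<omega>\<in>A \<inter> B. f \<omega> * g \<omega> \<partial>M) = (\<integral>\<omega>\<in>A. f \<omega> \<partial>M) * (\<integral>\<omega>\<in>B. g \<omega> \<partial>M)"
    using f g by (rule AB)
  also have "\<dots> = (\<integral>\<omega>\<in>A. cond_exp M u f \<omega> \<partial>M) * (\<integral>\<omega>\<in>B. cond_exp M v g \<omega> \<partial>M)"
    using u.real_cond_exp_intA[OF f(2), of A] v.real_cond_exp_intA[OF g(2), of B] A B u v
    by (simp add: sets_sigma_subfield)
  also have "\<dots> = (\<integral>\<omega>\<in>A \<inter> B. cond_exp M u f \<omega> * cond_exp M v g \<omega> \<partial>M)"
    by (rule AB[symmetric]) (use cu cv f g in auto)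
  finally show "(\<integral>\<omega>\<in>A \<inter> B. f \<omega> * g \<omega> \<partial>M)
    = (\<integral>\<omega>\<in>A \<inter> B. cond_exp M u f \<omega> * cond_exp M v g \<omega> \<partial>M)" .
qed (fact u(1), fact v(1))

end

section \<open>Lattice and independence properties of a noise-type Boolean algebra, and the bilinear
  estimate\<close>

locale noise = prob_space M for M :: "'w measure" +
  fixes B :: "'w set set set"
  assumes noise_type: "noise_type_boolean_algebra M B"
begin

lemma subfield: "x \<in> B \<Longrightarrow> x \<in> subfields M"
  and trivial_in: "trivial_field M \<in> B"
  and inter_in: "x \<in> B \<Longrightarrow> y \<in> B \<Longrightarrow> x \<inter> y \<in> B"
  and sigma_join_in: "x \<in> B \<Longrightarrow> y \<in> B \<Longrightarrow> sigma_join M x y \<in> B"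
  and distrib: "x \<in> B \<Longrightarrow> y \<in> B \<Longrightarrow> z \<in> B \<Longrightarrow>
    x \<inter> sigma_join M y z = sigma_join M (x \<inter> y) (x \<inter> z)"
  and complement_ex: "x \<in> B \<Longrightarrow> \<exists>x'\<in>B. complementary M x x'"
  and complement_indep: "x \<in> B \<Longrightarrow> x' \<in> B \<Longrightarrow> complementary M x x' \<Longrightarrow> indep_set x x'"
  using noise_type unfolding noise_type_boolean_algebra_def by blast+

text \<open>By distributivity \<open>y\<close> is the join of its parts in \<open>x\<close> and in
  \<open>x'\<close>, and the part in \<open>x\<close> is trivial.\<close>

lemma subset_complement:
  assumes x: "x \<in> B" "x' \<in> B" "complementary M x x'"
    and y: "y \<in> B" "x \<inter> y = trivial_field M"
  shows "y \<subseteq> x'"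
proof -
  have "y = y \<inter> sigma_join M x x'"
    using x(3) subfieldsD(2)[OF subfield[OF y(1)]] by (auto simp: complementary_def)
  also have "\<dots> = sigma_join M (trivial_field M) (y \<inter> x')"
    using distrib[OF y(1) x(1,2)] y(2) by (simp add: Int_commute)
  also have "\<dots> = y \<inter> x'"
    using sigma_join_absorb[OF trivial_field_subset] subfield[OF inter_in[OF y(1) x(2)]] by blast
  finally show ?thesis by blast
qed

text \<open>The definition grants independence to complementary pairs only; a disjoint
  \<open>y\<close> lies inside a complement of \<open>x\<close>, and independence passes to smaller
  fields.\<close>

lemma disjoint_indep:
  assumes "x \<in> B" "y \<in> B" "x \<inter> y = trivial_field M"
  shows "indep_set x y"
proof -
  obtain x' where "x' \<in> B" "complementary M x x'" using complement_ex assms by blast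
  then show ?thesis
    using indep_set_mono[OF complement_indep order_refl subset_complement] assms by blast
qed

text \<open>By distributivity the splitting of the whole field into \<open>x\<close> and
  \<open>x'\<close> restricts to every \<open>z\<close>. Conditioning a product on \<open>z\<close>
  thereby becomes conditioning each factor on its own part of \<open>z\<close>.\<close>

lemma sigma_join_inter_complement:
  assumes "x \<in> B" "x' \<in> B" "complementary M x x'" "z \<in> B"
  shows "sigma_join M (x \<inter> z) (x' \<inter> z) = z"
proof -
  have "z = z \<inter> sigma_join M x x'"
    using assms subfieldsD(2)[OF subfield] by (auto simp: complementary_def)
  then show ?thesis using distrib[OF assms(4,1,2)] by (simp add: Int_commute)
qed

text \<open>Conditioning on \<open>z i\<close> makes the form block diagonal, with blocks acting on
  \<open>F i\<close> and \<open>G i\<close>. Cauchy-Schwarz bounds block \<open>i\<close> by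
  \<epsilon> times the product of their norms, hence by \<epsilon> times the mean of the squared
  norms; Bessel's inequality sums these squares with no dependence on the number of pieces.\<close>

lemma bilinear_bound:
  fixes p :: "'i \<Rightarrow> 'w \<Rightarrow> real"
  assumes x: "x \<in> B" "x' \<in> B" "complementary M x x'"
    and I: "finite I" and z: "\<And>i. i \<in> I \<Longrightarrow> z i \<in> B"
    and disj: "\<And>i j. i \<in> I \<Longrightarrow> j \<in> I \<Longrightarrow> i \<noteq> j \<Longrightarrow> z i \<inter> z j = trivial_field M"
    and p: "\<And>i. i \<in> I \<Longrightarrow> p i \<in> borel_measurable (sigma (space M) (z i))"
      "\<And>i. i \<in> I \<Longrightarrow> integrable M (\<lambda>\<omega>. (p i \<omega>)\<^sup>2)"
      "\<And>i. i \<in> I \<Longrightarrow> (\<integral>\<omega>. (p i \<omega>)\<^sup>2 \<partial>M) \<le> \<epsilon>\<^sup>2" and \<epsilon>: "0 \<le> \<epsilon>"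
    and f: "f \<in> borel_measurable (sigma (space M) x)" "integrable M (\<lambda>\<omega>. (f \<omega>)\<^sup>2)"
      "(\<integral>\<omega>. f \<omega> \<partial>M) = 0"
    and g: "g \<in> borel_measurable (sigma (space M) x')" "integrable M (\<lambda>\<omega>. (g \<omega>)\<^sup>2)"
      "(\<integral>\<omega>. g \<omega> \<partial>M) = 0"
  shows "\<bar>\<integral>\<omega>. (\<Sum>i\<in>I. p i \<omega>) * (f \<omega> * g \<omega>) \<partial>M\<bar>
    \<le> \<epsilon> * ((\<integral>\<omega>. (f \<omega>)\<^sup>2 \<partial>M) + (\<integral>\<omega>. (g \<omega>)\<^sup>2 \<partial>M)) / 2"
proof -
  note sub = subalgebra_sigma_subfield[OF subfield]
  have indx: "indep_set x x'" using complement_indep x by blast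
  then have ind: "indep_set (sets (sigma (space M) x)) (sets (sigma (space M) x'))"
    using x by (simp add: sets_sigma_subfield subfield)
  have fM[measurable]: "f \<in> borel_measurable M" and gM[measurable]: "g \<in> borel_measurable M"
    using measurable_from_subalg f(1) g(1) sub x by blast+
  have f1: "integrable M f" and g1: "integrable M g"
    using square_integrable_imp_integrable f g fM gM by blast+
  define F G where "F i = cond_exp M (x \<inter> z i) f" and "G i = cond_exp M (x' \<inter> z i) g" for i
  have [measurable]: "F i \<in> borel_measurable M" "G i \<in> borel_measurable M" for i
    unfolding F_def G_def by auto
  have xz: "x \<inter> z i \<in> B" "x' \<inter> z i \<in> B" if "i \<in> I" for i using inter_in x z that by auto
  have F2: "integrable M (\<lambda>\<omega>. (F i \<omega>)\<^sup>2)" and G2: "integrable M (\<lambda>\<omega>. (G i \<omega>)\<^sup>2)" if "i \<in> I" for i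
    unfolding F_def G_def using integrable_real_cond_exp_square sub xz[OF that] f(2) g(2) by auto
  have Fx: "F i \<in> borel_measurable (sigma (space M) x)" if "i \<in> I" for i
    unfolding F_def using that x xz subfield
    by (intro borel_measurable_sigma_subfield_mono[OF _ _ _ borel_measurable_cond_exp]) auto
  have Gx: "G i \<in> borel_measurable (sigma (space M) x')" if "i \<in> I" for i
    unfolding G_def using that x xz subfield
    by (intro borel_measurable_sigma_subfield_mono[OF _ _ _ borel_measurable_cond_exp]) auto
  note im = indep_set_integral_mult[OF ind sub[OF x(1)] _ sub[OF x(2)]]
  \<comment> \<open>A product of two L2 functions is in general only integrable; here independence
    of \<open>x\<close> and \<open>x'\<close> makes it square integrable.\<close>
  have fg2: "integrable M (\<lambda>\<omega>. (f \<omega> * g \<omega>)\<^sup>2)"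
    unfolding power_mult_distrib using f g by (intro im(2)) auto
  have FG2: "integrable M (\<lambda>\<omega>. (F i \<omega> * G i \<omega>)\<^sup>2)"
    "(\<integral>\<omega>. (F i \<omega> * G i \<omega>)\<^sup>2 \<partial>M) = (\<integral>\<omega>. (F i \<omega>)\<^sup>2 \<partial>M) * (\<integral>\<omega>. (G i \<omega>)\<^sup>2 \<partial>M)" if "i \<in> I" for i
    unfolding power_mult_distrib using im[of "\<lambda>\<omega>. (F i \<omega>)\<^sup>2" "\<lambda>\<omega>. (G i \<omega>)\<^sup>2"]
      Fx[OF that] Gx[OF that] F2[OF that] G2[OF that] by simp_all
  have pM: "p i \<in> borel_measurable M" if "i \<in> I" for i
    using measurable_from_subalg p(1) sub z that by blast
  have pfg: "integrable M (\<lambda>\<omega>. p i \<omega> * (f \<omega> * g \<omega>))" if "i \<in> I" for i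
    using pM p(2) fg2 that by (intro integrable_mult_square_integrable) auto
  \<comment> \<open>As \<open>p i\<close> is measurable for \<open>z i\<close>, the product
    \<open>f \<omega> * g \<omega>\<close> may be replaced by its conditional expectation on
    \<open>z i\<close>. That field is the join of its parts in \<open>x\<close> and
    \<open>x'\<close>, so the product formula gives
    \<open>F i \<omega> * G i \<omega>\<close>.\<close>
  have reduce: "(\<integral>\<omega>. p i \<omega> * (f \<omega> * g \<omega>) \<partial>M) = (\<integral>\<omega>. p i \<omega> * (F i \<omega> * G i \<omega>) \<partial>M)"
    if i: "i \<in> I" for i
  proof -
    interpret zi: sigma_finite_subalgebra M "sigma (space M) (z i)"
      by (rule sigma_finite_subalgebraI[OF sub[OF z[OF i]]])
    have "(\<integral>\<omega>. p i \<omega> * (f \<omega> * g \<omega>) \<partial>M)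
        = (\<integral>\<omega>. p i \<omega> * cond_exp M (z i) (\<lambda>\<omega>. f \<omega> * g \<omega>) \<omega> \<partial>M)"
      using zi.real_cond_exp_intg(2)[OF pfg[OF i] p(1)[OF i]] by simp
    also have "\<dots> = (\<integral>\<omega>. p i \<omega> * (F i \<omega> * G i \<omega>) \<partial>M)"
    proof (rule integral_cong_AE)
      have "AE \<omega> in M. cond_exp M (sigma_join M (x \<inter> z i) (x' \<inter> z i)) (\<lambda>\<omega>. f \<omega> * g \<omega>) \<omega>
          = F i \<omega> * G i \<omega>"
        unfolding F_def G_def
        using cond_exp_mult_indep[OF subfield subfield indx] x subfield[OF xz(1)[OF i]]
          subfield[OF xz(2)[OF i]] f(1) f1 g(1) g1 by simp
      then show "AE \<omega> in M. p i \<omega> * cond_exp M (z i) (\<lambda>\<omega>. f \<omega> * g \<omega>) \<omega> = p i \<omega> * (F i \<omega> * G i \<omega>)"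
        unfolding sigma_join_inter_complement[OF x z[OF i]] by auto
    qed (use pM[OF i] in auto)
    finally show ?thesis .
  qed
  have piece: "\<bar>\<integral>\<omega>. p i \<omega> * (F i \<omega> * G i \<omega>) \<partial>M\<bar>
      \<le> \<epsilon> * ((\<integral>\<omega>. (F i \<omega>)\<^sup>2 \<partial>M) + (\<integral>\<omega>. (G i \<omega>)\<^sup>2 \<partial>M)) / 2" if i: "i \<in> I" for i
  proof (rule power2_le_imp_le)
    define s t where "s = (\<integral>\<omega>. (F i \<omega>)\<^sup>2 \<partial>M)" and "t = (\<integral>\<omega>. (G i \<omega>)\<^sup>2 \<partial>M)"
    have st: "0 \<le> s" "0 \<le> t" unfolding s_def t_def by auto
    have "\<bar>\<integral>\<omega>. p i \<omega> * (F i \<omega> * G i \<omega>) \<partial>M\<bar>\<^sup>2 \<le> (\<integral>\<omega>. (p i \<omega>)\<^sup>2 \<partial>M) * (s * t)"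
      using Cauchy_Schwarz_lebesgue_integral[OF pM[OF i] _ p(2)[OF i] FG2(1)[OF i]] FG2(2)[OF i]
      by (simp add: s_def t_def)
    also have "\<dots> \<le> \<epsilon>\<^sup>2 * (s * t)" using p(3)[OF i] st by (intro mult_right_mono) auto
    \<comment> \<open>Arithmetic-geometric mean inequality: it trades the product of norms for a sum
      of squares, the form to which Bessel's inequality applies.\<close>
    also have "\<dots> \<le> \<epsilon>\<^sup>2 * ((s + t) / 2)\<^sup>2"
      using sum_squares_bound[of s t]
      by (intro mult_left_mono) (auto simp: power2_eq_square field_simps)
    finally show "\<bar>\<integral>\<omega>. p i \<omega> * (F i \<omega> * G i \<omega>) \<partial>M\<bar>\<^sup>2 \<le> (\<epsilon> * ((\<integral>\<omega>. (F i \<omega>)\<^sup>2 \<partial>M) + (\<integral>\<omega>. (G i \<omega>)\<^sup>2 \<partial>M)) / 2)\<^sup>2"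
      by (simp add: s_def t_def power_mult_distrib power_divide)
    show "0 \<le> \<epsilon> * ((\<integral>\<omega>. (F i \<omega>)\<^sup>2 \<partial>M) + (\<integral>\<omega>. (G i \<omega>)\<^sup>2 \<partial>M)) / 2"
      using \<epsilon> by simp
  qed
  have indz: "indep_set (sets (sigma (space M) (y \<inter> z i))) (sets (sigma (space M) (y \<inter> z j)))"
    if "y \<in> B" "i \<in> I" "j \<in> I" "i \<noteq> j" for y i j
    using indep_set_mono[OF disjoint_indep[OF z z disj]] that inter_in z subfield
    by (simp add: sets_sigma_subfield)
  \<comment> \<open>Disjoint \<open>z i\<close> are independent, hence so are their parts in
    \<open>x\<close> and their parts in \<open>x'\<close>; this is where the zero means of
    \<open>f\<close> and \<open>g\<close> enter.\<close>
  have bessel: "(\<Sum>i\<in>I. \<integral>\<omega>. (F i \<omega>)\<^sup>2 \<partial>M) \<le> (\<integral>\<omega>. (f \<omega>)\<^sup>2 \<partial>M)"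
    "(\<Sum>i\<in>I. \<integral>\<omega>. (G i \<omega>)\<^sup>2 \<partial>M) \<le> (\<integral>\<omega>. (g \<omega>)\<^sup>2 \<partial>M)"
    unfolding F_def G_def
    using I f g indz x sub[OF xz(1)] sub[OF xz(2)] by (auto intro!: real_cond_exp_bessel)
  have "(\<integral>\<omega>. (\<Sum>i\<in>I. p i \<omega>) * (f \<omega> * g \<omega>) \<partial>M) = (\<Sum>i\<in>I. \<integral>\<omega>. p i \<omega> * (f \<omega> * g \<omega>) \<partial>M)"
    unfolding sum_distrib_right using pfg by simp
  also have "\<dots> = (\<Sum>i\<in>I. \<integral>\<omega>. p i \<omega> * (F i \<omega> * G i \<omega>) \<partial>M)"
    using reduce by simp
  finally have "\<bar>\<integral>\<omega>. (\<Sum>i\<in>I. p i \<omega>) * (f \<omega> * g \<omega>) \<partial>M\<bar>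
      \<le> (\<Sum>i\<in>I. \<bar>\<integral>\<omega>. p i \<omega> * (F i \<omega> * G i \<omega>) \<partial>M\<bar>)" by simp
  also have "\<dots> \<le> (\<Sum>i\<in>I. \<epsilon> * ((\<integral>\<omega>. (F i \<omega>)\<^sup>2 \<partial>M) + (\<integral>\<omega>. (G i \<omega>)\<^sup>2 \<partial>M)) / 2)"
    using piece by (rule sum_mono)
  also have "\<dots> = \<epsilon> * ((\<Sum>i\<in>I. \<integral>\<omega>. (F i \<omega>)\<^sup>2 \<partial>M) + (\<Sum>i\<in>I. \<integral>\<omega>. (G i \<omega>)\<^sup>2 \<partial>M)) / 2"
    by (simp add: sum.distrib flip: sum_divide_distrib sum_distrib_left)
  also have "\<dots> \<le> \<epsilon> * ((\<integral>\<omega>. (f \<omega>)\<^sup>2 \<partial>M) + (\<integral>\<omega>. (g \<omega>)\<^sup>2 \<partial>M)) / 2"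
    using bessel \<epsilon> by (intro divide_right_mono mult_left_mono add_mono) auto
  finally show ?thesis .
qed

end

section \<open>The projection \<open>Q\<close> as conditional expectation taken
  coordinatewise\<close>

lemma L2_subD:
  assumes "f \<in> L2_sub M x"
  shows "f \<in> borel_measurable (sigma (space M) x)" "f \<in> L2 M"
  using assms by (auto simp: L2_sub_def)

lemma L2_inner:
  assumes "f \<in> L2 M"
  shows "(\<lambda>\<omega>. f \<omega> \<bullet> e) \<in> borel_measurable M" "integrable M (\<lambda>\<omega>. (f \<omega> \<bullet> e)\<^sup>2)"
proof -
  have [measurable]: "f \<in> borel_measurable M" and f2: "integrable M (\<lambda>\<omega>. (norm (f \<omega>))\<^sup>2)"
    using assms by (auto simp: L2_def)
  show "(\<lambda>\<omega>. f \<omega> \<bullet> e) \<in> borel_measurable M" by simp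
  show "integrable M (\<lambda>\<omega>. (f \<omega> \<bullet> e)\<^sup>2)"
  proof (rule Bochner_Integration.integrable_bound)
    show "integrable M (\<lambda>\<omega>. (norm e)\<^sup>2 * (norm (f \<omega>))\<^sup>2)" using f2 by simp
    have "(a \<bullet> e)\<^sup>2 \<le> (norm e)\<^sup>2 * (norm a)\<^sup>2" for a :: 'b
      using power_mono[OF Cauchy_Schwarz_ineq2[of a e], of 2] by (simp add: power_mult_distrib mult.commute)
    then show "AE \<omega> in M. norm ((f \<omega> \<bullet> e)\<^sup>2) \<le> norm ((norm e)\<^sup>2 * (norm (f \<omega>))\<^sup>2)" by simp
  qed simp
qed

context prob_space
begin

text \<open>\<open>Q\<close> is a choice, so its defining properties require a witness: the function
  \<open>g\<close> whose coordinates are the conditional expectations of the coordinates of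
  \<open>f\<close>.\<close>

lemma Q_projection:
  fixes f :: "'a \<Rightarrow> 'b::{real_normed_field, euclidean_space}"
  assumes x: "x \<in> subfields M" and f: "f \<in> L2 M"
  shows "Q M x f \<in> L2_sub M x"
    and "h \<in> L2_sub M x \<Longrightarrow> (\<integral>\<omega>. (f \<omega> - Q M x f \<omega>) \<bullet> h \<omega> \<partial>M) = 0"
proof -
  note sub = subalgebra_sigma_subfield[OF x]
  interpret sigma_finite_subalgebra M "sigma (space M) x" by (rule sigma_finite_subalgebraI[OF sub])
  define c where "c e = cond_exp M x (\<lambda>\<omega>. f \<omega> \<bullet> e)" for e
  define g where "g \<omega> = (\<Sum>e\<in>Basis. c e \<omega> *\<^sub>R e)" for \<omega>
  have [measurable]: "c e \<in> borel_measurable M" "c e \<in> borel_measurable (sigma (space M) x)" for e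
    unfolding c_def by auto
  have c2: "integrable M (\<lambda>\<omega>. (c e \<omega>)\<^sup>2)" for e
    unfolding c_def using L2_inner[OF f] by (intro integrable_real_cond_exp_square sub)
  have "(norm (g \<omega>))\<^sup>2 = (\<Sum>e\<in>Basis. (c e \<omega>)\<^sup>2)" for \<omega>
    unfolding power2_norm_eq_inner g_def
    by (simp add: inner_sum_left inner_sum_right inner_Basis power2_eq_square if_distrib cong: if_cong)
  then have "integrable M (\<lambda>\<omega>. (norm (g \<omega>))\<^sup>2)" using c2 by simp
  moreover have "g \<in> borel_measurable M" "g \<in> borel_measurable (sigma (space M) x)"
    unfolding g_def by measurable
  ultimately have gsub: "g \<in> L2_sub M x" by (simp add: L2_sub_def L2_def)
  have orth: "(\<integral>\<omega>. (f \<omega> - g \<omega>) \<bullet> h \<omega> \<partial>M) = 0" if h: "h \<in> L2_sub M x" for h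
  proof -
    have hm: "(\<lambda>\<omega>. h \<omega> \<bullet> e) \<in> borel_measurable (sigma (space M) x)" for e
      using L2_subD(1)[OF h] by simp
    note h2 = L2_inner[OF L2_subD(2)[OF h]]
    have hf: "integrable M (\<lambda>\<omega>. (h \<omega> \<bullet> e) * (f \<omega> \<bullet> e))" for e
      using h2 L2_inner[OF f] by (intro integrable_mult_square_integrable) auto
    have hc: "integrable M (\<lambda>\<omega>. (h \<omega> \<bullet> e) * c e \<omega>)" for e
      using h2 c2 by (intro integrable_mult_square_integrable) auto
    have "(f \<omega> - g \<omega>) \<bullet> h \<omega> = (\<Sum>e\<in>Basis. (h \<omega> \<bullet> e) * (f \<omega> \<bullet> e) - (h \<omega> \<bullet> e) * c e \<omega>)" for \<omega>
    proof -
      have "g \<omega> \<bullet> e = c e \<omega>" if "e \<in> Basis" for e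
        unfolding g_def using that by (rule inner_sum_left_Basis)
      then show ?thesis
        unfolding euclidean_inner[of "f \<omega> - g \<omega>" "h \<omega>"]
        by (intro sum.cong refl) (simp add: inner_diff_left algebra_simps)
    qed
    then have "(\<integral>\<omega>. (f \<omega> - g \<omega>) \<bullet> h \<omega> \<partial>M)
        = (\<Sum>e\<in>Basis. (\<integral>\<omega>. (h \<omega> \<bullet> e) * (f \<omega> \<bullet> e) \<partial>M) - (\<integral>\<omega>. (h \<omega> \<bullet> e) * c e \<omega> \<partial>M))"
      using hf hc by simp
    \<comment> \<open>Each coordinate of \<open>h\<close> is measurable for \<open>x\<close>, so it
      has the same integral against a coordinate of \<open>f\<close> as against the conditional
      expectation of that coordinate.\<close>
    also have "\<dots> = 0"
      using real_cond_exp_intg(2)[OF hf hm] L2_inner(1)[OF f] by (simp add: c_def)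
    finally show ?thesis .
  qed
  have "Q M x f \<in> L2_sub M x \<and> (\<forall>h\<in>L2_sub M x. (\<integral>\<omega>. (f \<omega> - Q M x f \<omega>) \<bullet> h \<omega> \<partial>M) = 0)"
    unfolding Q_def by (rule someI[where x = g]) (use gsub orth in blast)
  then show "Q M x f \<in> L2_sub M x"
    "h \<in> L2_sub M x \<Longrightarrow> (\<integral>\<omega>. (f \<omega> - Q M x f \<omega>) \<bullet> h \<omega> \<partial>M) = 0" by auto
qed

text \<open>Testing orthogonality against \<open>indicator A \<omega> *\<^sub>R e\<close> gives the
  defining integral identity of conditional expectation, whichever representative \<open>Q\<close>
  has chosen. Statements about \<open>Q\<close> thereby reduce to real functions.\<close>

lemma cond_exp_inner_eq_Q:
  fixes f :: "'a \<Rightarrow> 'b::{real_normed_field, euclidean_space}"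
  assumes x: "x \<in> subfields M" and f: "f \<in> L2 M"
  shows "AE \<omega> in M. cond_exp M x (\<lambda>\<omega>. f \<omega> \<bullet> e) \<omega> = Q M x f \<omega> \<bullet> e"
proof -
  note sub = subalgebra_sigma_subfield[OF x]
  interpret sigma_finite_subalgebra M "sigma (space M) x" by (rule sigma_finite_subalgebraI[OF sub])
  note Q = Q_projection[OF x f]
  note int = square_integrable_imp_integrable[OF L2_inner]
  have fe: "integrable M (\<lambda>\<omega>. f \<omega> \<bullet> e)" by (rule int[OF f f])
  have Qe: "integrable M (\<lambda>\<omega>. Q M x f \<omega> \<bullet> e)" using int L2_subD(2)[OF Q(1)] by blast
  show ?thesis
  proof (rule real_cond_exp_charact)
    fix A assume A: "A \<in> sets (sigma (space M) x)"
    then have AM: "A \<in> sets M" using sub by (auto simp: subalgebra_def)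
    have "(\<lambda>\<omega>. (norm (indicator A \<omega> *\<^sub>R e :: 'b))\<^sup>2) = (\<lambda>\<omega>. indicator A \<omega> * (norm e)\<^sup>2)"
      by (auto simp: indicator_def)
    moreover have "integrable M (\<lambda>\<omega>. indicator A \<omega> * (norm e)\<^sup>2)"
      using AM by (intro integrable_mult_left integrable_const_bound[where B = 1]) auto
    ultimately have "(\<lambda>\<omega>. indicator A \<omega> *\<^sub>R e) \<in> L2_sub M x"
      using A AM by (simp add: L2_sub_def L2_def del: norm_scaleR)
    from Q(2)[OF this]
    have "(\<integral>\<omega>. indicator A \<omega> * (f \<omega> \<bullet> e) - indicator A \<omega> * (Q M x f \<omega> \<bullet> e) \<partial>M) = 0"
      by (simp add: inner_diff_left algebra_simps)
    then show "(\<integral>\<omega>\<in>A. f \<omega> \<bullet> e \<partial>M) = (\<integral>\<omega>\<in>A. Q M x f \<omega> \<bullet> e \<partial>M)"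
      using integrable_mult_indicator[OF AM fe] integrable_mult_indicator[OF AM Qe]
      by (simp add: set_lebesgue_integral_def)
  qed (use fe Qe L2_subD(1)[OF Q(1)] in auto)
qed

end

section \<open>Decomposition along a partition of unity, and passage from \<open>b\<close> to
  \<open>B\<close> for real functions\<close>

context noise
begin

text \<open>Additivity is given for two disjoint elements only, so the pieces are joined one at a
  time; distributivity keeps the remaining pieces disjoint from the join so far. The last join is
  the whole field, on which conditioning changes nothing.\<close>

lemma cond_exp_eq_sum_partition:
  assumes b: "boolean_subalgebra M b B" and \<phi>: "integrable M \<phi>"
    and add: "\<And>x y. x \<in> b \<Longrightarrow> y \<in> b \<Longrightarrow> x \<inter> y = trivial_field M \<Longrightarrow>
      AE \<omega> in M. cond_exp M (sigma_join M x y) \<phi> \<omega> = cond_exp M x \<phi> \<omega> + cond_exp M y \<phi> \<omega>"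
    and part: "partition_of_unity M b n x"
  shows "AE \<omega> in M. \<phi> \<omega> = (\<Sum>i\<in>{1..n}. cond_exp M (x i) \<phi> \<omega>)"
proof -
  have bB: "b \<subseteq> B" and bj: "\<And>y z. y \<in> b \<Longrightarrow> z \<in> b \<Longrightarrow> sigma_join M y z \<in> b"
    using b by (auto simp: boolean_subalgebra_def)
  have n: "1 \<le> n" and xb: "\<And>i. i \<in> {1..n} \<Longrightarrow> x i \<in> b"
    and top: "sigma_sets (space M) (\<Union>i\<in>{1..n}. x i) = sets M"
    and disj: "\<And>i j. i \<in> {1..n} \<Longrightarrow> j \<in> {1..n} \<Longrightarrow> i \<noteq> j \<Longrightarrow> x i \<inter> x j = trivial_field M"
    using part by (auto simp: partition_of_unity_def)
  \<comment> \<open>The induction starts at 1, where \<open>J 1\<close> is \<open>x 1\<close>: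
    \<open>J 0\<close> has just the empty set and the whole space as events and may lack null sets,
    so it need not belong to \<open>b\<close>.\<close>
  define J where "J k = sigma_sets (space M) (\<Union>i\<in>{1..k}. x i)" for k
  have triv: "sigma_join M (trivial_field M) (trivial_field M) = trivial_field M"
    by (rule sigma_join_absorb[OF order_refl subfield[OF trivial_in]])
  have J1: "J 1 = x 1"
    using subfieldsD(1)[OF subfield, of "x 1"] xb[of 1] n bB
    by (auto simp: J_def sigma_algebra.sigma_sets_eq)
  have J_Suc: "J (Suc k) = sigma_join M (J k) (x (Suc k))" for k
  proof (rule antisym)
    have "(\<Union>i\<in>{1..k}. x i) \<subseteq> J k" unfolding J_def by blast
    then have "(\<Union>i\<in>{1..Suc k}. x i) \<subseteq> J k \<union> x (Suc k)"
      by (auto simp: atLeastAtMostSuc_conv)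
    then show "J (Suc k) \<subseteq> sigma_join M (J k) (x (Suc k))"
      unfolding J_def[of "Suc k"] sigma_join_def by (rule sigma_sets_mono')
    have "J k \<subseteq> J (Suc k)"
      unfolding J_def by (intro sigma_sets_mono' UN_mono) auto
    moreover have "x (Suc k) \<subseteq> J (Suc k)"
      unfolding J_def
      by (rule order_trans[OF UN_upper sigma_sets_superset_generator]) simp
    ultimately show "sigma_join M (J k) (x (Suc k)) \<subseteq> J (Suc k)"
      unfolding sigma_join_def J_def[of "Suc k"] by (intro sigma_sets_mono Un_least)
  qed
  define P where "P k \<longleftrightarrow> J k \<in> b \<and> (\<forall>j\<in>{k<..n}. x j \<inter> J k = trivial_field M)
    \<and> (AE \<omega> in M. cond_exp M (J k) \<phi> \<omega> = (\<Sum>i\<in>{1..k}. cond_exp M (x i) \<phi> \<omega>))" for k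
  have "P n"
    using n
  proof (induction n rule: dec_induct)
    case base
    have "x j \<inter> x 1 = trivial_field M" if "j \<in> {1<..n}" for j
      using disj[of j 1] that by auto
    then show ?case using xb[of 1] n unfolding P_def J1 by simp
  next
    case (step k)
    let ?k = "Suc k"
    have k: "?k \<in> {1..n}" "k \<le> n" using step by auto
    from step.IH have IH: "J k \<in> b" "\<And>j. j \<in> {k<..n} \<Longrightarrow> x j \<inter> J k = trivial_field M"
      "AE \<omega> in M. cond_exp M (J k) \<phi> \<omega> = (\<Sum>i\<in>{1..k}. cond_exp M (x i) \<phi> \<omega>)"
      unfolding P_def by blast+
    have disj': "x j \<inter> J ?k = trivial_field M" if j: "j \<in> {?k<..n}" for j
    proof -
      have "x j \<in> B" "J k \<in> B" "x ?k \<in> B" using xb[of j] xb[OF k(1)] IH(1) bB j by auto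
      then have "x j \<inter> J ?k = sigma_join M (x j \<inter> J k) (x j \<inter> x ?k)"
        unfolding J_Suc by (rule distrib)
      also have "\<dots> = trivial_field M"
        using IH(2)[of j] disj[of j ?k] j k by (simp add: triv)
      finally show ?thesis .
    qed
    have "AE \<omega> in M. cond_exp M (J ?k) \<phi> \<omega> = cond_exp M (J k) \<phi> \<omega> + cond_exp M (x ?k) \<phi> \<omega>"
      unfolding J_Suc using IH(1) xb[OF k(1)] IH(2)[of ?k] k by (intro add) auto
    then have "AE \<omega> in M. cond_exp M (J ?k) \<phi> \<omega> = (\<Sum>i\<in>{1..?k}. cond_exp M (x i) \<phi> \<omega>)"
      using IH(3) by eventually_elim simp
    then show ?case using disj' bj[OF IH(1) xb[OF k(1)]] unfolding P_def J_Suc[of k] by blast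
  qed
  then have "AE \<omega> in M. cond_exp M (sets M) \<phi> \<omega> = (\<Sum>i\<in>{1..n}. cond_exp M (x i) \<phi> \<omega>)"
    using top by (simp add: P_def J_def)
  moreover have "AE \<omega> in M. cond_exp M (sets M) \<phi> \<omega> = \<phi> \<omega>"
  proof -
    interpret sigma_finite_subalgebra M "sigma (space M) (sets M)"
      by (rule sigma_finite_subalgebraI) (simp add: subalgebra_def)
    show ?thesis using \<phi> by (intro real_cond_exp_F_meas) (simp_all add: borel_measurable_integrable cong: measurable_cong_sets)
  qed
  ultimately show ?thesis by eventually_elim simp
qed

text \<open>The trivial field is disjoint from itself and equal to its join with itself, so
  additivity there says that the conditional expectation is twice itself, hence zero.\<close>

lemma integral_zero_of_additive:
  assumes b: "boolean_subalgebra M b B" and \<phi>: "integrable M \<phi>"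
    and add: "\<And>x y. x \<in> b \<Longrightarrow> y \<in> b \<Longrightarrow> x \<inter> y = trivial_field M \<Longrightarrow>
      AE \<omega> in M. cond_exp M (sigma_join M x y) \<phi> \<omega> = cond_exp M x \<phi> \<omega> + cond_exp M y \<phi> \<omega>"
  shows "(\<integral>\<omega>. \<phi> \<omega> \<partial>M) = 0"
proof -
  let ?o = "trivial_field M"
  interpret sigma_finite_subalgebra M "sigma (space M) ?o"
    by (rule sigma_finite_subalgebraI[OF subalgebra_sigma_subfield[OF subfield[OF trivial_in]]])
  have "AE \<omega> in M. cond_exp M (sigma_join M ?o ?o) \<phi> \<omega> = cond_exp M ?o \<phi> \<omega> + cond_exp M ?o \<phi> \<omega>"
    using b by (intro add) (auto simp: boolean_subalgebra_def)
  then have "AE \<omega> in M. cond_exp M ?o \<phi> \<omega> = 0"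
    unfolding sigma_join_absorb[OF order_refl subfield[OF trivial_in]] by eventually_elim simp
  then have "(\<integral>\<omega>. cond_exp M ?o \<phi> \<omega> \<partial>M) = 0"
    using integral_eq_zero_AE by blast
  then show ?thesis using real_cond_exp_int(2)[OF \<phi>] by simp
qed

text \<open>The real-valued case. Small pieces in \<open>bilinear_bound\<close> force the form to
  vanish on centred functions of \<open>x\<close> and \<open>x'\<close>; for centred indicators this
  is the required equality of integrals over rectangles.\<close>

lemma cond_exp_additive:
  assumes b: "boolean_subalgebra M b B"
    and \<phi>[measurable]: "\<phi> \<in> borel_measurable M" and \<phi>2: "integrable M (\<lambda>\<omega>. (\<phi> \<omega>)\<^sup>2)"
    and add: "\<And>x y. x \<in> b \<Longrightarrow> y \<in> b \<Longrightarrow> x \<inter> y = trivial_field M \<Longrightarrow>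
      AE \<omega> in M. cond_exp M (sigma_join M x y) \<phi> \<omega> = cond_exp M x \<phi> \<omega> + cond_exp M y \<phi> \<omega>"
    and atomless: "\<And>\<epsilon>. \<epsilon> > 0 \<Longrightarrow> \<exists>n x. partition_of_unity M b n x \<and>
      (\<forall>i\<in>{1..n}. (\<integral>\<omega>. (cond_exp M (x i) \<phi> \<omega>)\<^sup>2 \<partial>M) \<le> \<epsilon>\<^sup>2)"
    and xy: "x \<in> B" "y \<in> B" "x \<inter> y = trivial_field M"
  shows "AE \<omega> in M. cond_exp M (sigma_join M x y) \<phi> \<omega> = cond_exp M x \<phi> \<omega> + cond_exp M y \<phi> \<omega>"
proof -
  note sub = subalgebra_sigma_subfield[OF subfield]
  obtain x' where x': "x' \<in> B" "complementary M x x'" using complement_ex xy by blast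
  then have yx': "y \<subseteq> x'" using subset_complement xy by blast
  have \<phi>1: "integrable M \<phi>" using \<phi> \<phi>2 by (rule square_integrable_imp_integrable)
  have \<phi>0: "(\<integral>\<omega>. \<phi> \<omega> \<partial>M) = 0" using b \<phi>1 add by (rule integral_zero_of_additive)
  have vanish: "(\<integral>\<omega>. \<phi> \<omega> * (f \<omega> * g \<omega>) \<partial>M) = 0"
    if f: "f \<in> borel_measurable (sigma (space M) x)" "integrable M (\<lambda>\<omega>. (f \<omega>)\<^sup>2)"
      "(\<integral>\<omega>. f \<omega> \<partial>M) = 0"
    and g: "g \<in> borel_measurable (sigma (space M) x')" "integrable M (\<lambda>\<omega>. (g \<omega>)\<^sup>2)"
      "(\<integral>\<omega>. g \<omega> \<partial>M) = 0" for f g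
  proof -
    define K where "K = ((\<integral>\<omega>. (f \<omega>)\<^sup>2 \<partial>M) + (\<integral>\<omega>. (g \<omega>)\<^sup>2 \<partial>M)) / 2"
    have K: "0 \<le> K" unfolding K_def by simp
    have [measurable]: "f \<in> borel_measurable M" "g \<in> borel_measurable M"
      using measurable_from_subalg f(1) g(1) sub xy(1) x'(1) by blast+
    have bound: "\<bar>\<integral>\<omega>. \<phi> \<omega> * (f \<omega> * g \<omega>) \<partial>M\<bar> \<le> \<epsilon> * K" if \<epsilon>: "\<epsilon> > 0" for \<epsilon>
    proof -
      obtain n z where part: "partition_of_unity M b n z"
        and small: "\<And>i. i \<in> {1..n} \<Longrightarrow> (\<integral>\<omega>. (cond_exp M (z i) \<phi> \<omega>)\<^sup>2 \<partial>M) \<le> \<epsilon>\<^sup>2"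
        using atomless[OF \<epsilon>] by blast
      have z: "z i \<in> B" if "i \<in> {1..n}" for i
        using part b that unfolding partition_of_unity_def boolean_subalgebra_def by blast
      have "AE \<omega> in M. \<phi> \<omega> = (\<Sum>i\<in>{1..n}. cond_exp M (z i) \<phi> \<omega>)"
        using b \<phi>1 add part by (rule cond_exp_eq_sum_partition)
      then have "(\<integral>\<omega>. \<phi> \<omega> * (f \<omega> * g \<omega>) \<partial>M)
          = (\<integral>\<omega>. (\<Sum>i\<in>{1..n}. cond_exp M (z i) \<phi> \<omega>) * (f \<omega> * g \<omega>) \<partial>M)"
        by (intro integral_cong_AE) auto
      also have "\<bar>\<dots>\<bar> \<le> \<epsilon> * ((\<integral>\<omega>. (f \<omega>)\<^sup>2 \<partial>M) + (\<integral>\<omega>. (g \<omega>)\<^sup>2 \<partial>M)) / 2"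
      proof (rule bilinear_bound[OF xy(1) x' _ z])
        show "z i \<inter> z j = trivial_field M" if "i \<in> {1..n}" "j \<in> {1..n}" "i \<noteq> j" for i j
          using part that unfolding partition_of_unity_def by blast
        show "integrable M (\<lambda>\<omega>. (cond_exp M (z i) \<phi> \<omega>)\<^sup>2)" if "i \<in> {1..n}" for i
          using sub[OF z[OF that]] \<phi> \<phi>2 by (rule integrable_real_cond_exp_square)
      qed (use small \<epsilon> f g in auto)
      finally show ?thesis by (simp add: K_def)
    qed
    \<comment> \<open>The bound is used with \<delta> / (\<open>K\<close> + 1), where the 1 avoids
      division by zero if \<open>K = 0\<close>.\<close>
    have "\<bar>\<integral>\<omega>. \<phi> \<omega> * (f \<omega> * g \<omega>) \<partial>M\<bar> \<le> 0 + \<delta>" if \<delta>: "\<delta> > 0" for \<delta>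
    proof -
      have "\<bar>\<integral>\<omega>. \<phi> \<omega> * (f \<omega> * g \<omega>) \<partial>M\<bar> \<le> \<delta> / (K + 1) * K"
        using bound[of "\<delta> / (K + 1)"] \<delta> K by simp
      also have "\<dots> \<le> \<delta>" using \<delta> K by (simp add: field_simps)
      finally show ?thesis by simp
    qed
    from field_le_epsilon[OF this] show ?thesis by simp
  qed
  interpret x: sigma_finite_subalgebra M "sigma (space M) x"
    by (rule sigma_finite_subalgebraI[OF sub[OF xy(1)]])
  interpret y: sigma_finite_subalgebra M "sigma (space M) y"
    by (rule sigma_finite_subalgebraI[OF sub[OF xy(2)]])
  have indxy: "indep_set (sets (sigma (space M) x)) (sets (sigma (space M) y))"
    using disjoint_indep[OF xy] by (simp add: sets_sigma_subfield subfield xy)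
  note im = indep_set_integral_mult(1)[OF indxy sub[OF xy(1)] _ sub[OF xy(2)]]
  have j: "sigma_join M x y \<in> subfields M" using subfield sigma_join_in xy by blast
  show ?thesis
  proof (rule cond_exp_sigma_join_charact)
    show "integrable M (\<lambda>\<omega>. cond_exp M x \<phi> \<omega> + cond_exp M y \<phi> \<omega>)"
      using x.real_cond_exp_int(1)[OF \<phi>1] y.real_cond_exp_int(1)[OF \<phi>1] by simp
    have "cond_exp M x \<phi> \<in> borel_measurable (sigma (space M) (sigma_join M x y))"
      by (rule borel_measurable_sigma_subfield_mono[OF sigma_join_upper1 subfield[OF xy(1)] j
            borel_measurable_cond_exp])
    moreover have "cond_exp M y \<phi> \<in> borel_measurable (sigma (space M) (sigma_join M x y))"
      by (rule borel_measurable_sigma_subfield_mono[OF sigma_join_upper2 subfield[OF xy(2)] j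
            borel_measurable_cond_exp])
    ultimately show "(\<lambda>\<omega>. cond_exp M x \<phi> \<omega> + cond_exp M y \<phi> \<omega>)
        \<in> borel_measurable (sigma (space M) (sigma_join M x y))" by simp
    fix A C assume A: "A \<in> x" and C: "C \<in> y"
    have AM[measurable]: "A \<in> sets M" and CM[measurable]: "C \<in> sets M"
      using A C subfieldsD(2)[OF subfield] xy by blast+
    \<comment> \<open>Centred indicators of the two sides of the rectangle; \<open>vanish\<close>
      accepts \<open>g\<close> because \<open>C\<close> lies in \<open>y\<close> and hence in
      \<open>x'\<close>.\<close>
    define f g where "f \<omega> = indicator A \<omega> - prob A" and "g \<omega> = indicator C \<omega> - prob C" for \<omega>
    have Ax: "A \<in> sets (sigma (space M) x)" and Cy: "C \<in> sets (sigma (space M) y)"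
      and Cx': "C \<in> sets (sigma (space M) x')"
      using A C yx' by (auto simp: sets_sigma_subfield subfield xy x')
    have i: "integrable M (\<lambda>\<omega>. indicator D \<omega> * h \<omega>)" if "D \<in> sets M" "integrable M h"
      for D and h :: "'w \<Rightarrow> real"
      using integrable_mult_indicator[OF that] by simp
    have i1: "integrable M (indicator D :: 'w \<Rightarrow> real)" if "D \<in> sets M" for D
      using that by (intro integrable_const_bound[where B = 1]) auto
    have i2: "integrable M (\<lambda>\<omega>. indicator A \<omega> * (indicator C \<omega> * \<phi> \<omega>))"
      using i[OF AM i[OF CM \<phi>1]] .
    have sq: "integrable M (\<lambda>\<omega>. (indicator D \<omega> - prob D)\<^sup>2)" if "D \<in> sets M" for D
      by (rule integrable_const_bound[where B = 1])
        (use that in \<open>auto simp: indicator_def power2_eq_square abs_mult prob_le_1 intro!: mult_le_one\<close>)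
    have mean: "(\<integral>\<omega>. indicator D \<omega> - prob D \<partial>M) = 0" if "D \<in> sets M" for D
      using that i1[OF that] by (simp add: prob_space)
    have "(\<integral>\<omega>. \<phi> \<omega> * (f \<omega> * g \<omega>) \<partial>M) = 0"
      unfolding f_def g_def using Ax Cx' sq mean by (intro vanish) auto
    also have "(\<lambda>\<omega>. \<phi> \<omega> * (f \<omega> * g \<omega>)) = (\<lambda>\<omega>. indicator A \<omega> * (indicator C \<omega> * \<phi> \<omega>)
        - prob C * (indicator A \<omega> * \<phi> \<omega>) - prob A * (indicator C \<omega> * \<phi> \<omega>) + prob A * prob C * \<phi> \<omega>)"
      by (simp add: f_def g_def algebra_simps)
    \<comment> \<open>Of the four terms of the expanded product the last one drops out, because
      \<open>\<phi>\<close> has mean zero.\<close>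
    finally have AC: "(\<integral>\<omega>. indicator A \<omega> * (indicator C \<omega> * \<phi> \<omega>) \<partial>M)
        = prob C * (\<integral>\<omega>. indicator A \<omega> * \<phi> \<omega> \<partial>M) + prob A * (\<integral>\<omega>. indicator C \<omega> * \<phi> \<omega> \<partial>M)"
      using i2 i[OF AM \<phi>1] i[OF CM \<phi>1] \<phi>1 \<phi>0 by simp
    \<comment> \<open>By independence of \<open>x\<close> and \<open>y\<close>, the two terms on the
      right of \<open>AC\<close> are the integrals over \<open>A \<inter> C\<close> of the
      conditional expectations on \<open>x\<close> and on \<open>y\<close>.\<close>
    have X: "(\<integral>\<omega>. (indicator A \<omega> * cond_exp M x \<phi> \<omega>) * indicator C \<omega> \<partial>M)
        = prob C * (\<integral>\<omega>. indicator A \<omega> * \<phi> \<omega> \<partial>M)"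
    proof -
      have "(\<integral>\<omega>. (indicator A \<omega> * cond_exp M x \<phi> \<omega>) * indicator C \<omega> \<partial>M)
          = (\<integral>\<omega>. indicator A \<omega> * cond_exp M x \<phi> \<omega> \<partial>M) * (\<integral>\<omega>. indicator C \<omega> \<partial>M)"
        using Ax Cy i1[OF CM] i[OF AM x.real_cond_exp_int(1)[OF \<phi>1]] by (intro im) auto
      then show ?thesis
        using x.real_cond_exp_intg(2)[OF i[OF AM \<phi>1]] Ax by simp
    qed
    have Y: "(\<integral>\<omega>. indicator A \<omega> * (indicator C \<omega> * cond_exp M y \<phi> \<omega>) \<partial>M)
        = prob A * (\<integral>\<omega>. indicator C \<omega> * \<phi> \<omega> \<partial>M)"
    proof -
      have "(\<integral>\<omega>. indicator A \<omega> * (indicator C \<omega> * cond_exp M y \<phi> \<omega>) \<partial>M)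
          = (\<integral>\<omega>. indicator A \<omega> \<partial>M) * (\<integral>\<omega>. indicator C \<omega> * cond_exp M y \<phi> \<omega> \<partial>M)"
        using Ax Cy i1[OF AM] i[OF CM y.real_cond_exp_int(1)[OF \<phi>1]] by (intro im) auto
      then show ?thesis
        using y.real_cond_exp_intg(2)[OF i[OF CM \<phi>1]] Cy by simp
    qed
    have "integrable M (\<lambda>\<omega>. (indicator A \<omega> * cond_exp M x \<phi> \<omega>) * indicator C \<omega>)"
      "integrable M (\<lambda>\<omega>. indicator A \<omega> * (indicator C \<omega> * cond_exp M y \<phi> \<omega>))"
      using i[OF CM i[OF AM x.real_cond_exp_int(1)[OF \<phi>1]]]
        i[OF AM i[OF CM y.real_cond_exp_int(1)[OF \<phi>1]]] by (simp_all add: mult_ac)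
    then have "(\<integral>\<omega>\<in>A \<inter> C. cond_exp M x \<phi> \<omega> + cond_exp M y \<phi> \<omega> \<partial>M)
        = prob C * (\<integral>\<omega>. indicator A \<omega> * \<phi> \<omega> \<partial>M) + prob A * (\<integral>\<omega>. indicator C \<omega> * \<phi> \<omega> \<partial>M)"
      unfolding set_lebesgue_integral_def X[symmetric] Y[symmetric]
      by (subst Bochner_Integration.integral_add[symmetric])
        (auto simp: indicator_inter_arith algebra_simps intro!: Bochner_Integration.integral_cong)
    then show "(\<integral>\<omega>\<in>A \<inter> C. \<phi> \<omega> \<partial>M) = (\<integral>\<omega>\<in>A \<inter> C. cond_exp M x \<phi> \<omega> + cond_exp M y \<phi> \<omega> \<partial>M)"
      using AC by (simp add: set_lebesgue_integral_def indicator_inter_arith mult.assoc)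
  qed (use \<phi>1 subfield xy in auto)
qed

end

section \<open>Reduction of the scalar-valued statement to its real coordinates\<close>

theorem theorem1p2p1:
  fixes M :: "'w measure"
    and B b :: "'w set set set"
    and \<psi> :: "'w \<Rightarrow> 'a::{real_normed_field, euclidean_space}"
  assumes "prob_space M" and "complete_measure M"
    and "\<exists>D :: ('w \<Rightarrow> 'a) set. countable D \<and> L2_dense M D"
    and "noise_type_boolean_algebra M B"
    and "boolean_subalgebra M b B"
    and "\<psi> \<in> L2 M"
    and "\<And>x y. x \<in> b \<Longrightarrow> y \<in> b \<Longrightarrow> x \<inter> y = trivial_field M \<Longrightarrow>
           AE \<omega> in M. Q M (sigma_join M x y) \<psi> \<omega> = Q M x \<psi> \<omega> + Q M y \<psi> \<omega>"
    and "atomless M b \<psi>"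
  shows "\<psi> \<in> first_chaos M B"
proof -
  interpret noise M B using assms(1,4) by (simp add: noise_def noise_axioms_def)
  note \<psi> = assms(6)
  have bB: "z \<in> B" if "z \<in> b" for z using assms(5) that by (auto simp: boolean_subalgebra_def)
  note Q_inner = cond_exp_inner_eq_Q[OF subfield \<psi>]
  have "AE \<omega> in M. Q M (sigma_join M x y) \<psi> \<omega> = Q M x \<psi> \<omega> + Q M y \<psi> \<omega>"
    if xy: "x \<in> B" "y \<in> B" "x \<inter> y = trivial_field M" for x y
  proof -
    \<comment> \<open>Taking the coordinate along \<open>e\<close> turns every \<open>Q\<close> into
      a real conditional expectation, so both hypotheses pass to \<open>?\<phi>\<close> and the
      conclusion passes back.\<close>
    have "AE \<omega> in M. Q M (sigma_join M x y) \<psi> \<omega> \<bullet> e = (Q M x \<psi> \<omega> + Q M y \<psi> \<omega>) \<bullet> e"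
      if e: "e \<in> Basis" for e
    proof -
      let ?\<phi> = "\<lambda>\<omega>. \<psi> \<omega> \<bullet> e"
      have "AE \<omega> in M. cond_exp M (sigma_join M x y) ?\<phi> \<omega> = cond_exp M x ?\<phi> \<omega> + cond_exp M y ?\<phi> \<omega>"
      proof (rule cond_exp_additive[OF assms(5) L2_inner[OF \<psi>] _ _ xy])
        fix x y assume xy: "x \<in> b" "y \<in> b" "x \<inter> y = trivial_field M"
        show "AE \<omega> in M. cond_exp M (sigma_join M x y) ?\<phi> \<omega> = cond_exp M x ?\<phi> \<omega> + cond_exp M y ?\<phi> \<omega>"
          using assms(7)[OF xy] Q_inner[OF bB[OF xy(1)], of e] Q_inner[OF bB[OF xy(2)], of e]
            Q_inner[OF sigma_join_in[OF bB[OF xy(1)] bB[OF xy(2)]], of e]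
          by eventually_elim (simp add: inner_add_left)
      next
        fix \<epsilon> :: real assume \<epsilon>: "\<epsilon> > 0"
        then obtain n z where part: "partition_of_unity M b n z"
          and small: "\<And>i. i \<in> {1..n} \<Longrightarrow> L2_norm M (Q M (z i) \<psi>) \<le> \<epsilon>"
          using assms(8) unfolding atomless_def by blast
        have "(\<integral>\<omega>. (cond_exp M (z i) ?\<phi> \<omega>)\<^sup>2 \<partial>M) \<le> \<epsilon>\<^sup>2" if i: "i \<in> {1..n}" for i
        proof -
          have zi: "z i \<in> B" using part bB i by (auto simp: partition_of_unity_def)
          have QL: "Q M (z i) \<psi> \<in> L2 M"
            using L2_subD(2)[OF Q_projection(1)[OF subfield[OF zi] \<psi>]] .
          \<comment> \<open>A coordinate along a unit basis vector is at most the norm, so one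
            partition serves all coordinates with the same \<epsilon>.\<close>
          have "(\<integral>\<omega>. (cond_exp M (z i) ?\<phi> \<omega>)\<^sup>2 \<partial>M) \<le> (\<integral>\<omega>. (norm (Q M (z i) \<psi> \<omega>))\<^sup>2 \<partial>M)"
          proof (rule integral_mono_AE)
            show "integrable M (\<lambda>\<omega>. (cond_exp M (z i) ?\<phi> \<omega>)\<^sup>2)"
              using subalgebra_sigma_subfield[OF subfield[OF zi]] L2_inner[OF \<psi>]
              by (rule integrable_real_cond_exp_square)
            show "integrable M (\<lambda>\<omega>. (norm (Q M (z i) \<psi> \<omega>))\<^sup>2)" using QL by (simp add: L2_def)
            have "(a \<bullet> e)\<^sup>2 \<le> (norm a)\<^sup>2" for a :: 'a
              using power_mono[OF Basis_le_norm[OF e, of a], of 2] by simp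
            then show "AE \<omega> in M. (cond_exp M (z i) ?\<phi> \<omega>)\<^sup>2 \<le> (norm (Q M (z i) \<psi> \<omega>))\<^sup>2"
              using Q_inner[OF zi, of e] by auto
          qed
          also have "\<dots> = (L2_norm M (Q M (z i) \<psi>))\<^sup>2" by (simp add: L2_norm_def)
          also have "\<dots> \<le> \<epsilon>\<^sup>2"
            using small[OF i] by (intro power_mono) (auto simp: L2_norm_def)
          finally show ?thesis .
        qed
        then show "\<exists>n z. partition_of_unity M b n z \<and>
            (\<forall>i\<in>{1..n}. (\<integral>\<omega>. (cond_exp M (z i) ?\<phi> \<omega>)\<^sup>2 \<partial>M) \<le> \<epsilon>\<^sup>2)"
          using part by blast
      qed
      then show ?thesis
        using Q_inner[OF xy(1), of e] Q_inner[OF xy(2), of e]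
          Q_inner[OF sigma_join_in[OF xy(1,2)], of e]
        by eventually_elim (simp add: inner_add_left)
    qed
    \<comment> \<open>The basis is finite, so the exceptional null sets of the coordinates combine
      into one.\<close>
    then have "AE \<omega> in M. \<forall>e\<in>Basis. Q M (sigma_join M x y) \<psi> \<omega> \<bullet> e = (Q M x \<psi> \<omega> + Q M y \<psi> \<omega>) \<bullet> e"
      by (intro AE_finite_allI) auto
    then show ?thesis by eventually_elim (rule euclidean_eqI, blast)
  qed
  then show ?thesis using \<psi> by (simp add: first_chaos_def)
qed

end
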